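(* For all $k,n\in\mathbb{N}$ and every $u=(u_0,\ldots,u_{n-1})\in\mathbb{C}^n$, if $v=ku=(ku_0,\ldots,ku_{n-1})$, then $$PF_n(v)=k^n\,PF_n(u).$$
   Context: For $u=(u_0,\ldots,u_{n-1})$ a sequence of nonnegative integers (weakly increasing), a $u$-parking function of length $n$ is a sequence of positive integers $(c_1,\ldots,c_n)$ whose non-decreasing rearrangement $c_{(1)}\le\cdots\le c_{(n)}$ satisfies $c_{(i)}\le u_{i-1}$ for $1\le i\le n$; $PF_n(u)$ denotes their number. For complex $u$, $PF_n(u)$ is defined by the Gončarov polynomials associated with the derivative operator: for a sequence $Z=(z_i)_{i\ge 0}$ of complex numbers, the polynomials $t_i(x;Z)$ are determined recursively by $$x^m=\sum_{i=0}^{m}\binom{m}{i}z_i^{\,m-i}\,t_i(x;Z)\qquad(m\ge 0),$$ (with $z^0=1$; $t_n(x;Z)$ depends only on $z_0,\ldots,z_{n-1}$), and $$PF_n(u)=t_n(0;-u_0,\ldots,-u_{n-1})=(-1)^n t_n(0;u_0,\ldots,u_{n-1}),$$ which agrees with the counting definition when $u$ is a weakly increasing integer sequence. *)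

theory Defs
  imports Complex_Main "HOL-Computational_Algebra.Polynomial"
begin

text \<open>
  The Goncarov polynomials of the derivative operator, for a grid \<^term>\<open>Z\<close>. The function
  equation is the recursion \<open>x^m = (\<Sum>i\<le>m. (m choose i) * z\<^sub>i^(m-i) * t\<^sub>i(x;Z))\<close> solved for its
  top term, whose coefficient is 1.
\<close>

fun goncarov :: "(nat \<Rightarrow> complex) \<Rightarrow> nat \<Rightarrow> complex poly" where
  "goncarov Z m =
     monom 1 m - (\<Sum>i<m. smult (of_nat (m choose i) * Z i ^ (m - i)) (goncarov Z i))"

declare goncarov.simps [simp del]

lemma goncarov_recursion:
  "monom 1 m = (\<Sum>i\<le>m. smult (of_nat (m choose i) * Z i ^ (m - i)) (goncarov Z i))"
  by (simp add: goncarov.simps[of Z m] flip: lessThan_Suc_atMost)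

lemma goncarov_unique:
  assumes "\<And>m. monom 1 m = (\<Sum>i\<le>m. smult (of_nat (m choose i) * Z i ^ (m - i)) (t i))"
  shows "t m = goncarov Z m"
proof (induction m rule: less_induct)
  case (less m)
  have "t m = monom 1 m - (\<Sum>i<m. smult (of_nat (m choose i) * Z i ^ (m - i)) (t i))"
    using assms[of m] by (simp flip: lessThan_Suc_atMost)
  also have "\<dots> = goncarov Z m"
    using less by (simp add: goncarov.simps[of Z m])
  finally show ?case .
qed

lemma goncarov_cong:
  assumes "\<And>i. i < m \<Longrightarrow> Z i = Z' i"
  shows "goncarov Z m = goncarov Z' m"
  using assms
proof (induction m rule: less_induct)
  case (less m)
  then show ?case by (simp add: goncarov.simps[of _ m])
qed

text \<open>
  The number of \<open>u\<close>-parking functions of length \<open>n\<close>, extended to complex \<open>u\<close>. The tuple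
  \<open>(u\<^sub>0, \<dots>, u\<^sub>n\<^sub>-\<^sub>1)\<close> is given by a function on the naturals, of which only the values
  below \<open>n\<close> matter.
\<close>

definition PF :: "nat \<Rightarrow> (nat \<Rightarrow> complex) \<Rightarrow> complex" where
  "PF n u = poly (goncarov (\<lambda>i. - u i) n) 0"

lemma PF_cong:
  assumes "\<And>i. i < n \<Longrightarrow> u i = v i"
  shows "PF n u = PF n v"
  unfolding PF_def using assms by (auto intro!: arg_cong[where f = "\<lambda>p. poly p 0"] goncarov_cong)

end

theory Submission imports Defs begin

text \<open>Goncarov polynomials are jointly homogeneous: give \<open>x\<close> and every node
  degree 1; then by induction each term of the recursion for index \<open>m\<close> has total degree
  \<open>m\<close> (\<open>poly_goncarov_scale\<close>). Evaluating at 0, a point fixed by scaling,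
  leaves homogeneity in the nodes alone.\<close>

lemma poly_goncarov_scale:
  "poly (goncarov (\<lambda>i. c * Z i) m) (c * x) = c ^ m * poly (goncarov Z m) x"
proof (induction m rule: less_induct)
  case (less m)
  have "of_nat (m choose i) * (c * Z i) ^ (m - i) * poly (goncarov (\<lambda>i. c * Z i) i) (c * x)
      = c ^ m * (of_nat (m choose i) * Z i ^ (m - i) * poly (goncarov Z i) x)" if "i < m" for i
  proof -
    \<comment> \<open>The node power supplies the first factor, the induction hypothesis for
      \<open>i\<close> the second.\<close>
    have "c ^ m = c ^ (m - i) * c ^ i"
      using that by (simp flip: power_add)
    then show ?thesis
      using less.IH[OF that] by (simp add: power_mult_distrib mult_ac)
  qed
  then have "(\<Sum>i<m. of_nat (m choose i) * (c * Z i) ^ (m - i)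
                * poly (goncarov (\<lambda>i. c * Z i) i) (c * x))
      = c ^ m * (\<Sum>i<m. of_nat (m choose i) * Z i ^ (m - i) * poly (goncarov Z i) x)"
    unfolding sum_distrib_left by (intro sum.cong) auto
  then show ?case
    by (simp only: goncarov.simps[of _ m] poly_diff poly_sum poly_smult poly_monom
        power_mult_distrib[of c x] right_diff_distrib mult_1)
qed

theorem theorem2p1:
  fixes k n :: nat and u v :: "nat \<Rightarrow> complex"
  assumes "\<And>i. i < n \<Longrightarrow> v i = of_nat k * u i"
  shows "PF n v = of_nat k ^ n * PF n u"
proof -
  have "PF n v = PF n (\<lambda>i. of_nat k * u i)"
    using assms by (rule PF_cong)
  also have "\<dots> = of_nat k ^ n * PF n u"
    \<comment> \<open>The sign in \<open>PF_def\<close> commutes with scaling, and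
      \<open>of_nat k * 0\<close> is again 0.\<close>
    using poly_goncarov_scale[of "of_nat k" "\<lambda>i. - u i" n 0] by (simp add: PF_def)
  finally show ?thesis .
qed

end
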